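(* For each $s \in (0,1]$, the set $\mathcal{D}^{(s)}_{\mathrm{div}} = \{ x \in [0,1] : \sum_{n \in \mathbb{N}} 1/(d_n(x))^{s} \text{ diverges} \}$ has Hausdorff dimension $1-s$.
   Context: Pierce digits. For $x \in [0,1]$, define $d_1(x) := \lfloor 1/x \rfloor$ and $T(x) := 1 - d_1(x)\,x$ if $x \neq 0$, and $d_1(0) := \infty$, $T(0) := 0$. Here $\lfloor y \rfloor$ is the largest integer not exceeding $y$. For $n \in \mathbb{N} = \{1,2,3,\dots\}$ put $d_n(x) := d_1(T^{n-1}(x))$, where $T^{n-1}$ is the $(n-1)$-fold iterate of $T$ ($T^0$ is the identity). The sequence $(d_n(x))_{n \in \mathbb{N}}$ is the Pierce expansion digit sequence of $x$. Conventions: $\infty^s := \infty$ for $s>0$ and $c/\infty := 0$ for $c \in \mathbb{R}$. Hausdorff dimension is the usual one: for non-empty $F \subseteq [0,1]$ it is $\inf\{ t \geq 0 : \mathcal{H}^t(F) = 0 \}$, with $\mathcal{H}^t$ the $t$-dimensional Hausdorff measure. *)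

theory Defs
  imports "HOL-Analysis.Analysis" "HOL-Library.Extended_Nat"
begin

section \<open>Hausdorff measure and Hausdorff dimension\<close>

text \<open>
  The \<open>t\<close>-th power of the diameter of a set, with the usual conventions
  \<open>0\<close> for the empty set and \<open>1\<close> for non-empty sets if \<open>t = 0\<close>.
  The case distinction is needed because \<open>0 powr 0 = 0\<close>. The value is meaningful for bounded
  sets only, since \<^const>\<open>diameter\<close> is unspecified on unbounded ones.
\<close>

definition diam_pow :: "real \<Rightarrow> 'a::metric_space set \<Rightarrow> ennreal" where
  "diam_pow t U = (if U = {} then 0 else if t = 0 then 1 else ennreal (diameter U powr t))"

definition hausdorff_premeasure :: "real \<Rightarrow> real \<Rightarrow> 'a::metric_space set \<Rightarrow> ennreal" where
  "hausdorff_premeasure t \<delta> F =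
     (INF U \<in> {U :: nat \<Rightarrow> 'a set. F \<subseteq> (\<Union>n. U n) \<and> (\<forall>n. bounded (U n) \<and> diameter (U n) \<le> \<delta>)}.
        \<Sum>n. diam_pow t (U n))"

definition hausdorff_measure :: "real \<Rightarrow> 'a::metric_space set \<Rightarrow> ennreal" where
  "hausdorff_measure t F = (SUP \<delta> \<in> {0<..}. hausdorff_premeasure t \<delta> F)"

text \<open>
  The dimension is extended-real-valued, so that the infimum is \<open>\<infinity>\<close> if no measure
  vanishes. The empty set gets the value \<open>-\<infinity>\<close>; thus a set with a real
  Hausdorff dimension is in particular non-empty.
\<close>

definition hausdorff_dim :: "'a::metric_space set \<Rightarrow> ereal" where
  "hausdorff_dim F =
     (if F = {} then -\<infinity> else INF t \<in> {t. 0 \<le> t \<and> hausdorff_measure t F = 0}. ereal t)"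


section \<open>Pierce expansions\<close>

text \<open>The following functions are meant for arguments in \<open>[0,1]\<close>.\<close>

definition pierce_d1 :: "real \<Rightarrow> enat" where
  "pierce_d1 x = (if x = 0 then \<infinity> else enat (nat \<lfloor>1 / x\<rfloor>))"

definition pierce_T :: "real \<Rightarrow> real" where
  "pierce_T x = (if x = 0 then 0 else 1 - real (the_enat (pierce_d1 x)) * x)"

text \<open>The digits are indexed by \<open>n \<ge> 1\<close>.\<close>

definition pierce_digit :: "nat \<Rightarrow> real \<Rightarrow> enat" where
  "pierce_digit n x = pierce_d1 ((pierce_T ^^ (n - 1)) x)"

text \<open>\<open>1 / d\<^sup>s\<close> for \<open>s > 0\<close>, with \<open>\<infinity>\<^sup>s = \<infinity>\<close> and \<open>1 / \<infinity> = 0\<close>.\<close>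

definition recip_powr :: "enat \<Rightarrow> real \<Rightarrow> real" where
  "recip_powr d s = (case d of enat k \<Rightarrow> 1 / (real k powr s) | \<infinity> \<Rightarrow> 0)"

definition pierce_div :: "real \<Rightarrow> real set" where
  "pierce_div s = {x \<in> {0..1}. \<not> summable (\<lambda>n. recip_powr (pierce_digit (Suc n) x) s)}"

end

theory Submission
  imports Defs
begin

text \<open>
  Let \<open>d\<^sub>1 < d\<^sub>2 < \<dots>\<close> be the digits of \<open>x\<close>. In both directions of the proof the quantity that matters
  is the product of the first \<open>n\<close> digits: \<open>T\<close> expands distances by the factor \<open>d\<^sub>1\<close> between
  points with the same first digit, so points that share \<open>n\<close> digits are at most \<open>1 / (d\<^sub>1 \<cdots> d\<^sub>n)\<close> apart.

  Dimension at most \<open>1 - s\<close>. Let \<open>1 - s < t < 1\<close> and choose \<open>p\<close> with \<open>1 / s < p < 1 / (1 - t)\<close>. If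
  \<open>d\<^sub>n > n\<^sup>p\<close> held for almost all \<open>n\<close>, then the series of the \<open>d\<^sub>n\<^bsup>- s\<^esup>\<close> would converge. So a point of the
  divergence set has, for infinitely many \<open>n\<close>, its first \<open>n\<close> digits in \<open>{1..n\<^sup>p}\<close>
  (\<open>frequently_digit_le\<close>). The cylinders that this condition allows at level \<open>n\<close> correspond to the
  \<open>n\<close>-element subsets of \<open>{1..n\<^sup>p}\<close>, and the sum of the \<open>t\<close>-th powers of their diameters is at most an
  elementary symmetric polynomial in the numbers \<open>a\<^bsup>- t\<^esup>\<close>. The elementary estimate
  \<open>sum_prod_card_le\<close> bounds it by \<open>(C n\<^bsup>- \<eta>\<^esup>)\<^sup>n\<close> with \<open>\<eta> = 1 - p (1 - t) > 0\<close>, which is summable over \<open>n\<close>.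
  By the Borel-Cantelli argument for Hausdorff measures (\<open>hausdorff_measure_limsup_eq_0\<close>), the
  \<open>t\<close>-dimensional measure vanishes.

  Dimension at least \<open>1 - s\<close>. Put \<open>q = 1 / s - 1\<close>. Let the digit with index \<open>n\<close> range over a block of about
  \<open>n\<^sup>q\<close> consecutive integers, the blocks following one another. Then all digits satisfy
  \<open>d\<^sub>n \<le> 3 n\<^bsup>1/s\<^esup>\<close>, and the series of the \<open>d\<^sub>n\<^bsup>- s\<^esup>\<close> diverges with the harmonic series. Selecting from the
  blocks by the mixed radix expansion of \<open>y \<in> [0,1)\<close> gives a map \<open>cantor_point q\<close> from \<open>[0,1)\<close> into
  the divergence set. Up to factors that are exponential in \<open>n\<close>, numbers that agree in \<open>n\<close> places of the expansion
  differ by at most \<open>(n!)\<^bsup>- q\<^esup>\<close>, whereas the first difference in the digits separates their images by at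
  least \<open>(n!)\<^bsup>- (q + 1)\<^esup>\<close>. As \<open>q / (q + 1) = 1 - s\<close>, for each \<open>t < 1 - s\<close> the distance of two
  numbers is bounded by a multiple of the \<open>t\<close>-th power of the distance of their images. A cover of the
  divergence set with a small sum of the \<open>t\<close>-th powers of the diameters would therefore induce a cover of \<open>[0,1)\<close> of
  Lebesgue measure less than \<open>1\<close> (\<open>hausdorff_measure_neq_0_if_inverse_Hoelder\<close>).

  For \<open>s = 1\<close> there is no \<open>t\<close> to consider in the second part, but the divergence set must still be
  non-empty; the points \<open>cantor_point 0 y\<close> show this.
\<close>

section \<open>Sets of vanishing and of positive Hausdorff measure\<close>

text \<open>
  The Borel-Cantelli lemma for Hausdorff measures: each tail of the sequence \<open>V\<close> covers \<open>F\<close>, the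
  tails of the sum become arbitrarily small, and the diameters tend to \<open>0\<close> because their \<open>t\<close>-th
  powers are summable, so that late tails are admissible for every mesh \<open>\<delta>\<close>.
\<close>

lemma hausdorff_measure_limsup_eq_0:
  fixes V :: "nat \<Rightarrow> 'a::metric_space set"
  assumes "t > 0" and bdd: "\<And>k. bounded (V k)"
    and summ: "summable (\<lambda>k. diameter (V k) powr t)"
    and F: "\<And>x. x \<in> F \<Longrightarrow> \<exists>\<^sub>\<infinity>k. x \<in> V k"
  shows "hausdorff_measure t F = 0"
proof -
  have "hausdorff_premeasure t \<delta> F \<le> ennreal \<epsilon>" if "\<delta> > 0" "\<epsilon> > 0" for \<delta> \<epsilon>
  proof -
    have "(\<lambda>k. diameter (V k) powr t) \<longlonglongrightarrow> 0"
      using summ by (rule summable_LIMSEQ_zero)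
    then have "\<forall>\<^sub>F k in sequentially. diameter (V k) powr t < \<delta> powr t"
      using \<open>\<delta> > 0\<close> by (intro order_tendstoD(2)) auto
    then have "\<forall>\<^sub>F k in sequentially. diameter (V k) \<le> \<delta>"
    proof eventually_elim
      case (elim k)
      show ?case
      proof (rule ccontr)
        assume "\<not> diameter (V k) \<le> \<delta>"
        then have "\<delta> powr t \<le> diameter (V k) powr t"
          using \<open>\<delta> > 0\<close> \<open>t > 0\<close> by (intro powr_mono2) auto
        with elim show False by simp
      qed
    qed
    moreover have "\<forall>\<^sub>F K in sequentially. norm (\<Sum>k. diameter (V (k + K)) powr t) < \<epsilon>"
      using suminf_exist_split[OF \<open>\<epsilon> > 0\<close> summ] by (auto simp: eventually_sequentially)
    ultimately obtain K1 K2 where K12: "\<And>k. k \<ge> K1 \<Longrightarrow> diameter (V k) \<le> \<delta>"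
        "\<And>K. K \<ge> K2 \<Longrightarrow> norm (\<Sum>k. diameter (V (k + K)) powr t) < \<epsilon>"
      unfolding eventually_sequentially by metis
    define K where "K = max K1 K2"
    have K: "\<And>k. k \<ge> K \<Longrightarrow> diameter (V k) \<le> \<delta>"
        "norm (\<Sum>k. diameter (V (k + K)) powr t) < \<epsilon>"
      using K12 by (auto simp: K_def)
    have cover: "F \<subseteq> (\<Union>k. V (k + K))"
    proof
      fix x assume "x \<in> F"
      then obtain k where "k \<ge> K" "x \<in> V k"
        using F by (auto simp: INFM_nat_le)
      then show "x \<in> (\<Union>k. V (k + K))"
        by (intro UN_I[of "k - K"]) auto
    qed
    have "hausdorff_premeasure t \<delta> F \<le> (\<Sum>k. diam_pow t (V (k + K)))"
      unfolding hausdorff_premeasure_def using cover bdd K(1) by (intro INF_lower) auto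
    also have "\<dots> \<le> (\<Sum>k. ennreal (diameter (V (k + K)) powr t))"
      using \<open>t > 0\<close> by (intro suminf_le) (auto simp: diam_pow_def)
    also have "\<dots> = ennreal (\<Sum>k. diameter (V (k + K)) powr t)"
      using summ by (intro suminf_ennreal2) (auto intro: summable_ignore_initial_segment)
    also have "\<dots> \<le> ennreal \<epsilon>"
      using K(2) by (intro ennreal_leI) auto
    finally show ?thesis .
  qed
  then have "hausdorff_premeasure t \<delta> F \<le> 0" if "\<delta> > 0" for \<delta>
    using that by - (rule ennreal_le_epsilon, simp)
  then have "hausdorff_measure t F \<le> 0"
    unfolding hausdorff_measure_def by (intro SUP_least) (simp only: greaterThan_iff)
  then show ?thesis by simp
qed

text \<open>
  The mass distribution principle, with Lebesgue measure transported along \<open>g\<close> in place of a measure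
  on \<open>F\<close>. The hypothesis says that \<open>g\<close> is injective and its inverse is Hoelder continuous with exponent
  \<open>t\<close>. So the preimages of a cover of \<open>F\<close> lie in intervals of length at most
  \<open>2 C\<close> times the \<open>t\<close>-th powers of the diameters, and these intervals cover \<open>[0,1)\<close>.
\<close>

lemma hausdorff_measure_neq_0_if_inverse_Hoelder:
  fixes g :: "real \<Rightarrow> 'a::metric_space"
  assumes "t \<ge> 0" "C > 0" and gF: "g ` {0..<1} \<subseteq> F"
    and Hoelder: "\<And>y z. \<lbrakk>y \<in> {0..<1}; z \<in> {0..<1}; y \<noteq> z\<rbrakk>
      \<Longrightarrow> \<bar>y - z\<bar> \<le> C * dist (g y) (g z) powr t"
  shows "hausdorff_measure t F \<noteq> 0"
proof -
  have sum_ge: "ennreal (1 / (2 * C)) \<le> (\<Sum>n. diam_pow t (U n))"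
    if cover: "F \<subseteq> (\<Union>n. U n)" and bdd: "\<And>n. bounded (U n)" for U :: "nat \<Rightarrow> 'a set"
  proof -
    define P where "P n = {y \<in> {0..<1}. g y \<in> U n}" for n
    have "\<exists>c r. P n \<subseteq> cball c r \<and> r \<ge> 0 \<and> ennreal r \<le> ennreal C * diam_pow t (U n)" for n
    proof (cases "P n = {}")
      case True
      then show ?thesis by (intro exI[of _ 0]) auto
    next
      case False
      then obtain c where c: "c \<in> P n" by blast
      then have ne: "U n \<noteq> {}" by (auto simp: P_def)
      \<comment> \<open>For \<open>t = 0\<close> the term of a non-empty set in the premeasure is \<open>1\<close>, even if the
         diameter is \<open>0\<close>.\<close>
      define r where "r = (if t = 0 then C else C * diameter (U n) powr t)"
      have "\<bar>c - z\<bar> \<le> r" if z: "z \<in> P n" for z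
      proof (cases "c = z")
        case True
        then show ?thesis using \<open>C > 0\<close> by (simp add: r_def)
      next
        case False
        have "dist (g c) (g z) \<le> diameter (U n)"
          using c z bdd by (intro diameter_bounded_bound) (auto simp: P_def)
        then have "C * dist (g c) (g z) powr t \<le> r"
          using \<open>C > 0\<close> \<open>t \<ge> 0\<close> by (cases "g c = g z") (auto simp: r_def intro!: powr_mono2)
        then show ?thesis
          using Hoelder[of c z] c z False by (auto simp: P_def)
      qed
      moreover have "r \<ge> 0" using \<open>C > 0\<close> by (simp add: r_def)
      moreover have "ennreal r \<le> ennreal C * diam_pow t (U n)"
        using ne \<open>C > 0\<close> by (auto simp: r_def diam_pow_def ennreal_mult')
      ultimately show ?thesis
        by (intro exI[of _ c] exI[of _ r]) (auto simp: dist_real_def)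
    qed
    then obtain c r where cr: "\<And>n. P n \<subseteq> cball (c n) (r n)" "\<And>n. r n \<ge> 0"
        "\<And>n. ennreal (r n) \<le> ennreal C * diam_pow t (U n)"
      by metis
    have "{0..<1} \<subseteq> (\<Union>n. P n)"
    proof
      fix y :: real assume y: "y \<in> {0..<1}"
      then have "g y \<in> (\<Union>n. U n)" using gF cover by blast
      with y show "y \<in> (\<Union>n. P n)" by (auto simp: P_def)
    qed
    also have "\<dots> \<subseteq> (\<Union>n. cball (c n) (r n))"
      using cr(1) by blast
    finally have "emeasure lborel {0..<1::real} \<le> emeasure lborel (\<Union>n. cball (c n) (r n))"
      by (intro emeasure_mono) auto
    also have "\<dots> \<le> (\<Sum>n. emeasure lborel (cball (c n) (r n)))"
      by (intro emeasure_subadditive_countably) auto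
    also have "\<dots> \<le> (\<Sum>n. ennreal (2 * C) * diam_pow t (U n))"
    proof (intro suminf_le allI)
      fix n
      have "emeasure lborel (cball (c n) (r n)) = ennreal (2 * r n)"
        using cr(2)[of n] by (simp add: cball_eq_atLeastAtMost)
      also have "\<dots> = 2 * ennreal (r n)"
        by (simp add: ennreal_mult')
      also have "\<dots> \<le> 2 * (ennreal C * diam_pow t (U n))"
        using cr(3) by (intro mult_left_mono) auto
      also have "\<dots> = ennreal (2 * C) * diam_pow t (U n)"
        using \<open>C > 0\<close> by (simp add: ennreal_mult' mult.assoc)
      finally show "emeasure lborel (cball (c n) (r n)) \<le> ennreal (2 * C) * diam_pow t (U n)" .
    qed auto
    also have "\<dots> = ennreal (2 * C) * (\<Sum>n. diam_pow t (U n))"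
      by simp
    finally have "1 \<le> ennreal (2 * C) * (\<Sum>n. diam_pow t (U n))" by simp
    then have "ennreal (1 / (2 * C)) * 1 \<le> ennreal (1 / (2 * C)) * (ennreal (2 * C) * (\<Sum>n. diam_pow t (U n)))"
      by (intro mult_left_mono) auto
    also have "\<dots> = ennreal (1 / (2 * C) * (2 * C)) * (\<Sum>n. diam_pow t (U n))"
      using \<open>C > 0\<close> by (subst ennreal_mult) (auto simp: mult.assoc)
    finally show ?thesis using \<open>C > 0\<close> by simp
  qed
  have "ennreal (1 / (2 * C)) \<le> hausdorff_premeasure t 1 F"
    unfolding hausdorff_premeasure_def using sum_ge by (intro INF_greatest) auto
  also have "\<dots> \<le> hausdorff_measure t F"
    unfolding hausdorff_measure_def by (intro SUP_upper) auto
  finally have "ennreal (1 / (2 * C)) \<le> hausdorff_measure t F" .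
  moreover have "0 < ennreal (1 / (2 * C))"
    using \<open>C > 0\<close> by (simp add: ennreal_less_zero_iff)
  ultimately show ?thesis by (metis leD)
qed

section \<open>Digits and cylinders\<close>

text \<open>
  The points whose digits are all finite; on them the digits can be handled as natural numbers.
\<close>

definition infinite_pierce :: "real set" where
  "infinite_pierce = {x \<in> {0..1}. \<forall>n. (pierce_T ^^ n) x \<noteq> 0}"

definition digit :: "real \<Rightarrow> nat \<Rightarrow> nat" where
  "digit x n = the_enat (pierce_digit (Suc n) x)"

lemma pierce_d1_T:
  assumes "x \<in> {0<..1}"
  obtains d where "d \<ge> 1" "pierce_d1 x = enat d" "real d * x \<le> 1" "1 < (real d + 1) * x"
    "pierce_T x = 1 - real d * x"
proof
  let ?d = "nat \<lfloor>1 / x\<rfloor>"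
  have fl: "\<lfloor>1 / x\<rfloor> \<ge> 1"
    using assms by (simp add: le_floor_iff)
  then have d: "real ?d = of_int \<lfloor>1 / x\<rfloor>" by (intro of_nat_nat) linarith
  show "?d \<ge> 1" using fl by linarith
  show d1: "pierce_d1 x = enat ?d" using assms by (simp add: pierce_d1_def)
  show "real ?d * x \<le> 1"
    using assms of_int_floor_le[of "1 / x"] unfolding d by (simp only: greaterThanAtMost_iff pos_le_divide_eq)
  have "1 / x < real ?d + 1" unfolding d by linarith
  then show "1 < (real ?d + 1) * x" using assms by (simp add: field_simps)
  show "pierce_T x = 1 - real ?d * x" using assms d1 by (simp add: pierce_T_def)
qed

lemma pierce_T_range: "x \<in> {0..1} \<Longrightarrow> pierce_T x \<in> {0..1}"
proof (cases "x = 0")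
  case False
  assume "x \<in> {0..1}"
  with False obtain d where "real d * x \<le> 1" "pierce_T x = 1 - real d * x"
    using pierce_d1_T[of x] by auto
  then show ?thesis using \<open>x \<in> {0..1}\<close> by auto
qed (simp add: pierce_T_def)

lemma pierce_T_iterate_range: "x \<in> {0..1} \<Longrightarrow> (pierce_T ^^ n) x \<in> {0..1}"
  by (induction n) (simp_all add: pierce_T_range del: atLeastAtMost_iff)

context
  fixes x assumes x: "x \<in> infinite_pierce"
begin

lemma iterate_pos: "(pierce_T ^^ n) x \<in> {0<..1}"
  using x pierce_T_iterate_range[of x n] by (auto simp: infinite_pierce_def less_le)

lemma pierce_digit_eq: "pierce_digit (Suc n) x = enat (digit x n)"
  using pierce_d1_T[OF iterate_pos[of n]] by (metis diff_Suc_1 digit_def pierce_digit_def the_enat.simps)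

lemma digit_bounds:
  shows "digit x n \<ge> 1" "real (digit x n) * (pierce_T ^^ n) x \<le> 1"
    "1 < (real (digit x n) + 1) * (pierce_T ^^ n) x"
    "(pierce_T ^^ Suc n) x = 1 - real (digit x n) * (pierce_T ^^ n) x"
proof -
  obtain d where d: "d \<ge> 1" "pierce_d1 ((pierce_T ^^ n) x) = enat d" "real d * (pierce_T ^^ n) x \<le> 1"
      "1 < (real d + 1) * (pierce_T ^^ n) x"
      "pierce_T ((pierce_T ^^ n) x) = 1 - real d * (pierce_T ^^ n) x"
    using pierce_d1_T[OF iterate_pos[of n]] by metis
  have "digit x n = d" by (simp add: digit_def pierce_digit_def d(2))
  with d show "digit x n \<ge> 1" "real (digit x n) * (pierce_T ^^ n) x \<le> 1"
    "1 < (real (digit x n) + 1) * (pierce_T ^^ n) x"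
    "(pierce_T ^^ Suc n) x = 1 - real (digit x n) * (pierce_T ^^ n) x"
    by simp_all
qed

text \<open>
  If \<open>d\<close> is the first digit of \<open>u\<close>, then \<open>u > 1 / (d + 1)\<close> and hence \<open>T u = 1 - d u < 1 / (d + 1)\<close>,
  which forces a larger digit.
\<close>

lemma strict_mono_digit: "strict_mono (digit x)"
proof (rule strict_monoI_Suc)
  fix n
  let ?d = "real (digit x n)" and ?e = "real (digit x (Suc n))"
  let ?u = "(pierce_T ^^ n) x" and ?v = "(pierce_T ^^ Suc n) x"
  have "?v > 0" using iterate_pos[of "Suc n"] by simp
  have "1 < (?d + 1) * ?u" by (rule digit_bounds(3))
  then have "?d < ?d * ((?d + 1) * ?u)"
    using digit_bounds(1)[of n] by simp
  then have "(?d + 1) * ?v < 1"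
    unfolding digit_bounds(4) by (simp add: algebra_simps)
  also have "1 < (?e + 1) * ?v" by (rule digit_bounds(3))
  finally show "digit x n < digit x (Suc n)" using \<open>?v > 0\<close> by simp
qed

end

text \<open>
  On the points with first digit \<open>d\<close> the map \<open>T\<close> is affine with slope \<open>-d\<close>.
\<close>

lemma iterate_dist:
  assumes x: "x \<in> infinite_pierce" and y: "y \<in> infinite_pierce"
    and "\<And>i. i < n \<Longrightarrow> digit x i = digit y i"
  shows "\<bar>(pierce_T ^^ n) x - (pierce_T ^^ n) y\<bar> = (\<Prod>i<n. real (digit x i)) * \<bar>x - y\<bar>"
  using assms(3)
proof (induction n)
  case (Suc n)
  have "(pierce_T ^^ Suc n) x - (pierce_T ^^ Suc n) y =
      - (real (digit x n) * ((pierce_T ^^ n) x - (pierce_T ^^ n) y))"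
    unfolding digit_bounds(4)[OF x] digit_bounds(4)[OF y] using Suc.prems[of n]
    by (simp add: algebra_simps)
  then have "\<bar>(pierce_T ^^ Suc n) x - (pierce_T ^^ Suc n) y\<bar> =
      real (digit x n) * \<bar>(pierce_T ^^ n) x - (pierce_T ^^ n) y\<bar>"
    by (simp only: abs_minus_cancel abs_mult abs_of_nat)
  then show ?case using Suc by (simp del: funpow.simps)
qed simp

lemma strict_mono_image_lessThan_eq:
  fixes f g :: "nat \<Rightarrow> nat"
  assumes "strict_mono f" "strict_mono g" "f ` {..<n} = g ` {..<n}" "i < n"
  shows "f i = g i"
proof -
  have "sorted_wrt (<) (map h [0..<n])" if "strict_mono h" for h :: "nat \<Rightarrow> nat"
    using that by (auto simp: sorted_wrt_iff_nth_less strict_mono_less)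
  then have "map f [0..<n] = map g [0..<n]"
    using assms by (intro strict_sorted_equal) (auto simp: atLeast0LessThan)
  then show ?thesis using \<open>i < n\<close> by (simp add: list_eq_iff_nth_eq)
qed

text \<open>
  Because digits increase, the set of the first \<open>n\<close> digits determines their order
  (\<open>strict_mono_image_lessThan_eq\<close>). Indexing cylinders by finite sets instead of sequences turns the
  sum over a level of cylinders into a sum over subsets, as in the product expansion behind \<open>sum_prod_card_le\<close>.
\<close>

definition cylinder :: "nat set \<Rightarrow> real set" where
  "cylinder A = {x \<in> infinite_pierce. digit x ` {..<card A} = A}"

lemma bounded_cylinder: "bounded (cylinder A)"
  by (rule bounded_subset[of "{0..1}"]) (auto simp: cylinder_def infinite_pierce_def)

lemma diameter_cylinder:
  assumes "A \<subseteq> {0<..}"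
  shows "diameter (cylinder A) \<le> 1 / (\<Prod>a\<in>A. real a)"
proof (rule diameter_le)
  fix x y assume xy: "x \<in> cylinder A" "y \<in> cylinder A"
  then have x: "x \<in> infinite_pierce" and y: "y \<in> infinite_pierce"
    and A: "digit x ` {..<card A} = A" "digit y ` {..<card A} = A"
    by (auto simp: cylinder_def)
  note mono = strict_mono_digit[OF x] strict_mono_digit[OF y]
  have "(\<Prod>a\<in>A. real a) = (\<Prod>i<card A. real (digit x i))"
    using prod.reindex[of "digit x" "{..<card A}" real] strict_mono_imp_inj_on[OF mono(1)]
    by (simp add: A(1) inj_on_subset)
  then have "(\<Prod>a\<in>A. real a) * \<bar>x - y\<bar> =
      \<bar>(pierce_T ^^ card A) x - (pierce_T ^^ card A) y\<bar>"
    using iterate_dist[OF x y strict_mono_image_lessThan_eq[OF mono, of "card A"]] A by simp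
  also have "\<dots> \<le> 1"
    using iterate_pos[OF x, of "card A"] iterate_pos[OF y, of "card A"] by auto
  finally show "norm (x - y) \<le> 1 / (\<Prod>a\<in>A. real a)"
    using prod_pos[of A real] assms by (subst pos_le_divide_eq) (auto simp: mult.commute)
qed (use assms in \<open>auto intro!: prod_nonneg\<close>)

text \<open>
  A point with an infinite digit has only infinite digits from there on, so its series is a finite sum.
\<close>

lemma pierce_div_eq:
  assumes "s > 0"
  shows "pierce_div s = {x \<in> infinite_pierce. \<not> summable (\<lambda>n. real (digit x n) powr - s)}"
proof -
  have "x \<in> infinite_pierce" if "x \<in> pierce_div s" for x
  proof (rule ccontr)
    assume "x \<notin> infinite_pierce"
    with that obtain m where m: "(pierce_T ^^ m) x = 0"
      by (auto simp: infinite_pierce_def pierce_div_def)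
    have "(pierce_T ^^ (n + m)) x = 0" for n
      using m by (induction n) (simp_all add: pierce_T_def)
    then have "(pierce_T ^^ n) x = 0" if "n \<ge> m" for n
      using that by (metis le_add_diff_inverse2)
    then have "recip_powr (pierce_digit (Suc n) x) s = 0" if "n \<ge> m" for n
      using that by (simp add: pierce_digit_def pierce_d1_def recip_powr_def)
    then have "summable (\<lambda>n. recip_powr (pierce_digit (Suc n) x) s)"
      by (intro summable_finite[of "{..<m}"]) (auto simp: not_less)
    with \<open>x \<in> pierce_div s\<close> show False by (simp add: pierce_div_def)
  qed
  moreover have "x \<in> pierce_div s \<longleftrightarrow> \<not> summable (\<lambda>n. real (digit x n) powr - s)"
    if x: "x \<in> infinite_pierce" for x
  proof -
    have "recip_powr (pierce_digit (Suc n) x) s = real (digit x n) powr - s" for n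
      using x by (simp add: pierce_digit_eq recip_powr_def powr_minus_divide)
    moreover have "x \<in> {0..1}" using x by (simp add: infinite_pierce_def)
    ultimately show ?thesis by (simp add: pierce_div_def)
  qed
  ultimately show ?thesis by blast
qed

text \<open>
  Otherwise the terms of the series would eventually be bounded by \<open>n\<^bsup>- p s\<^esup>\<close>, which is summable.
\<close>

lemma frequently_digit_le:
  assumes "s > 0" "p * s > 1" and x: "x \<in> pierce_div s"
  shows "\<exists>\<^sub>\<infinity>n. real (digit x n) \<le> real (Suc n) powr p"
proof (rule ccontr)
  assume "\<not> (\<exists>\<^sub>\<infinity>n. real (digit x n) \<le> real (Suc n) powr p)"
  then have "\<forall>\<^sub>F n in sequentially. real (Suc n) powr p \<le> real (digit x n)"
    by (auto simp: frequently_def cofinite_eq_sequentially elim: eventually_mono)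
  then have "\<forall>\<^sub>F n in sequentially. norm (real (digit x n) powr - s) \<le> real (Suc n) powr (p * - s)"
  proof eventually_elim
    case (elim n)
    have "real (digit x n) powr - s \<le> (real (Suc n) powr p) powr - s"
      using elim \<open>s > 0\<close> by (intro powr_mono2') auto
    then show ?case by (simp add: powr_powr)
  qed
  moreover have "summable (\<lambda>n. real (Suc n) powr (p * - s))"
    using assms by (subst summable_Suc_iff) (simp add: summable_real_powr_iff)
  ultimately have "summable (\<lambda>n. real (digit x n) powr - s)"
    by (rule summable_comparison_test_ev)
  with x \<open>s > 0\<close> show False by (simp add: pierce_div_eq)
qed

section \<open>The upper bound for the dimension\<close>

text \<open>
  A bound for elementary symmetric polynomials: weighted by \<open>z ^ n\<close>, the left-hand side consists of
  some of the non-negative terms in the expansion of the product of all \<open>1 + z f b\<close>, and such a factor is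
  at most \<open>exp (z f b)\<close>.
\<close>

lemma sum_prod_card_le:
  fixes f :: "'a \<Rightarrow> real"
  assumes "finite B" "\<And>b. b \<in> B \<Longrightarrow> f b \<ge> 0" "z > 0"
  shows "(\<Sum>A | A \<subseteq> B \<and> card A = n. \<Prod>a\<in>A. f a) \<le> exp (z * (\<Sum>b\<in>B. f b)) / z ^ n"
proof -
  have "(\<Sum>A | A \<subseteq> B \<and> card A = n. \<Prod>a\<in>A. f a) * z ^ n = (\<Sum>A | A \<subseteq> B \<and> card A = n. \<Prod>a\<in>A. z * f a)"
    unfolding sum_distrib_right by (intro sum.cong) (auto simp: prod.distrib)
  also have "\<dots> \<le> (\<Sum>A\<in>Pow B. (\<Prod>a\<in>A. z * f a) * (\<Prod>a\<in>B - A. 1))"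
    using assms by (simp, intro sum_mono2) (auto intro!: prod_nonneg mult_nonneg_nonneg)
  also have "\<dots> = (\<Prod>b\<in>B. z * f b + 1)"
    using assms(1) by (rule prod_add[symmetric])
  also have "\<dots> \<le> (\<Prod>b\<in>B. exp (z * f b))"
    using assms by (intro prod_mono) (auto simp: add.commute intro!: exp_ge_add_one_self add_nonneg_nonneg)
  also have "\<dots> = exp (z * (\<Sum>b\<in>B. f b))"
    using assms(1) by (simp add: exp_sum sum_distrib_left)
  finally show ?thesis
    using assms(3) by (simp add: pos_le_divide_eq)
qed

text \<open>
  Comparison with the integral of \<open>x\<^bsup>- t\<^esup>\<close>. The increment from \<open>N\<close> to \<open>N + 1\<close> reduces to the weighted
  inequality of the arithmetic and geometric mean \<open>N\<^bsup>1 - t\<^esup> (N + 1)\<^bsup>t\<^esup> \<le> N + t\<close>.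
\<close>

lemma sum_powr_neg_le:
  assumes "0 < t" "t < 1"
  shows "(\<Sum>a=1..N. real a powr - t) \<le> real N powr (1 - t) / (1 - t)"
proof (induction N)
  case (Suc N)
  have "real N powr (1 - t) \<le> real (Suc N) powr (1 - t) - (1 - t) * real (Suc N) powr - t"
  proof (cases "N = 0")
    case False
    have "real N powr (1 - t) * real (Suc N) powr t \<le> (1 - t) * real N + t * real (Suc N)"
      using assms False by (intro Youngs_inequality_0) auto
    also have "\<dots> = real (Suc N) - (1 - t)" by (simp add: algebra_simps)
    finally have "real N powr (1 - t) * real (Suc N) powr t * real (Suc N) powr - t
        \<le> (real (Suc N) - (1 - t)) * real (Suc N) powr - t"
      by (intro mult_right_mono) auto
    moreover have "real (Suc N) * real (Suc N) powr - t = real (Suc N) powr (1 - t)"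
      by (simp add: powr_diff powr_minus_divide)
    moreover have "real (Suc N) powr t * real (Suc N) powr - t = 1"
      by (simp add: powr_minus)
    ultimately show ?thesis by (simp only: mult.assoc left_diff_distrib)
  qed (use assms in auto)
  then have "real (Suc N) powr - t \<le> (real (Suc N) powr (1 - t) - real N powr (1 - t)) / (1 - t)"
    using assms by (simp add: pos_le_divide_eq algebra_simps)
  with Suc show ?case by (simp add: diff_divide_distrib)
qed simp

text \<open>
  The weight \<open>z\<close> below is chosen such that \<open>z\<close> times the sum of the \<open>a\<^bsup>- t\<^esup>\<close>, which is at most
  \<open>n\<^bsup>1 - \<eta>\<^esup> / (1 - t)\<close>, does not exceed \<open>n + 1\<close>. Up to constants this is the optimal choice in
  \<open>sum_prod_card_le\<close>; the shift from \<open>n\<close> to \<open>n + 1\<close> keeps \<open>z\<close> positive for \<open>n = 0\<close>.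
\<close>

lemma sum_diameter_cylinder_le:
  assumes t: "0 < t" "t < 1" and "p > 0" and N: "real N \<le> real n powr p"
    and \<eta>: "\<eta> = 1 - p * (1 - t)" "\<eta> > 0"
  shows "(\<Sum>A | A \<subseteq> {1..N} \<and> card A = n. diameter (cylinder A) powr t)
    \<le> exp 1 * (exp 1 / (1 - t) * real (Suc n) powr - \<eta>) ^ n"
proof -
  define z where "z = (1 - t) * real (Suc n) powr \<eta>"
  have "z > 0" using t by (simp add: z_def)
  have "(\<Sum>A | A \<subseteq> {1..N} \<and> card A = n. diameter (cylinder A) powr t)
      \<le> (\<Sum>A | A \<subseteq> {1..N} \<and> card A = n. \<Prod>a\<in>A. real a powr - t)"
  proof (rule sum_mono)
    fix A assume "A \<in> {A. A \<subseteq> {1..N} \<and> card A = n}"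
    then have A: "A \<subseteq> {0<..}" by auto
    have "diameter (cylinder A) powr t \<le> (1 / (\<Prod>a\<in>A. real a)) powr t"
      using diameter_cylinder[OF A] t by (intro powr_mono2 diameter_ge_0 bounded_cylinder) auto
    also have "\<dots> = (\<Prod>a\<in>A. real a powr - t)"
      by (simp add: powr_divide powr_minus_divide prod_powr_distrib prod_dividef prod_nonneg)
    finally show "diameter (cylinder A) powr t \<le> (\<Prod>a\<in>A. real a powr - t)" .
  qed
  also have "\<dots> \<le> exp (z * (\<Sum>a=1..N. real a powr - t)) / z ^ n"
    using \<open>z > 0\<close> by (intro sum_prod_card_le) auto
  also have "\<dots> \<le> exp (real (Suc n)) / z ^ n"
  proof -
    have "(\<Sum>a=1..N. real a powr - t) \<le> real N powr (1 - t) / (1 - t)"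
      using t by (rule sum_powr_neg_le)
    also have "\<dots> \<le> (real n powr p) powr (1 - t) / (1 - t)"
      using N t by (intro divide_right_mono powr_mono2) auto
    also have "\<dots> \<le> real (Suc n) powr (1 - \<eta>) / (1 - t)"
      using t \<open>p > 0\<close> by (auto simp: powr_powr \<eta>(1) intro!: divide_right_mono powr_mono2)
    finally have "z * (\<Sum>a=1..N. real a powr - t) \<le> z * (real (Suc n) powr (1 - \<eta>) / (1 - t))"
      using \<open>z > 0\<close> by (intro mult_left_mono) auto
    also have "\<dots> = real (Suc n) powr \<eta> * real (Suc n) powr (1 - \<eta>)"
      using t by (simp add: z_def)
    also have "\<dots> = real (Suc n)"
      by (simp flip: powr_add)
    finally show ?thesis
      using \<open>z > 0\<close> by (intro divide_right_mono) auto
  qed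
  also have "\<dots> = exp 1 * (exp 1 / z) ^ n"
    by (simp add: exp_add power_divide flip: exp_of_nat_mult)
  also have "exp 1 / z = exp 1 / (1 - t) * real (Suc n) powr - \<eta>"
    by (simp add: z_def powr_minus_divide)
  finally show ?thesis .
qed

text \<open>
  The cylinders of all levels form one sequence \<open>V\<close>, enumerated by the binary encoding of finite sets
  of natural numbers. A set \<open>A\<close> of digits is admitted, that is, belongs to \<open>\<G>\<close>, if its elements are at most \<open>n\<^sup>p\<close> with
  \<open>n = card A\<close>.
\<close>

lemma hausdorff_measure_pierce_div_eq_0:
  assumes "0 < s" "1 - s < t" "0 < t" "t < 1"
  shows "hausdorff_measure t (pierce_div s) = 0"
proof -
  have "1 / s < 1 / (1 - t)" using assms by (intro divide_strict_left_mono) auto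
  then obtain p where p: "1 / s < p" "p < 1 / (1 - t)" using dense by blast
  have ps: "p * s > 1" "p * (1 - t) < 1" using p assms by (simp_all add: field_simps)
  have "p > 0" using p(1) assms by (smt (verit) divide_pos_pos)
  define \<eta> where "\<eta> = 1 - p * (1 - t)"
  have "\<eta> > 0" using ps by (simp add: \<eta>_def)
  define N where "N n = nat \<lfloor>real n powr p\<rfloor>" for n
  have N: "real (N n) \<le> real n powr p" for n by (simp add: N_def)
  define \<G> where "\<G> = {A. A \<subseteq> {1..N (card A)}}"
  define V where "V k = (if set_decode k \<in> \<G> then cylinder (set_decode k) else {})" for k
  define w where "w n = exp 1 * (exp 1 / (1 - t) * real (Suc n) powr - \<eta>) ^ n" for n
  have w_nonneg: "w n \<ge> 0" for n using assms by (simp add: w_def)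
  have "summable w"
  proof (rule summable_comparison_test_ev)
    have "(\<lambda>n. exp 1 / (1 - t) * real (Suc n) powr - \<eta>) \<longlonglongrightarrow> exp 1 / (1 - t) * 0"
      using \<open>\<eta> > 0\<close>
      by (intro tendsto_intros tendsto_neg_powr filterlim_compose[OF filterlim_real_sequentially filterlim_Suc]) auto
    then have "\<forall>\<^sub>F n in sequentially. exp 1 / (1 - t) * real (Suc n) powr - \<eta> < 1 / 2"
      by (intro order_tendstoD(2)) auto
    then show "\<forall>\<^sub>F n in sequentially. norm (w n) \<le> exp 1 * (1 / 2) ^ n"
    proof eventually_elim
      case (elim n)
      have "w n \<le> exp 1 * (1 / 2) ^ n"
        unfolding w_def using elim assms by (intro mult_left_mono power_mono) auto
      then show ?case using w_nonneg[of n] by simp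
    qed
    show "summable (\<lambda>n. exp 1 * (1 / 2 :: real) ^ n)"
      by (intro summable_mult summable_geometric) auto
  qed
  show ?thesis
  proof (rule hausdorff_measure_limsup_eq_0)
    show "bounded (V k)" for k by (simp add: V_def bounded_cylinder)
    \<comment> \<open>Finitely many cylinders are grouped by their levels, and every level is
    extended to the sum over all its admitted sets.\<close>
    show "summable (\<lambda>k. diameter (V k) powr t)"
    proof (rule summableI_nonneg_bounded)
      fix n
      define \<K> where "\<K> = set_decode ` {..<n} \<inter> \<G>"
      define h where "h A = diameter (cylinder A) powr t" for A
      have "finite \<K>" by (simp add: \<K>_def)
      have "inj_on set_decode {..<n}"
        by (metis inj_on_inverseI set_decode_inverse)
      have "(\<Sum>k<n. diameter (V k) powr t) = (\<Sum>k<n. if set_decode k \<in> \<G> then h (set_decode k) else 0)"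
        by (intro sum.cong) (auto simp: V_def h_def)
      also have "\<dots> = (\<Sum>A\<in>set_decode ` {..<n}. if A \<in> \<G> then h A else 0)"
        using \<open>inj_on set_decode {..<n}\<close> by (simp add: sum.reindex)
      also have "\<dots> = (\<Sum>A\<in>\<K>. h A)"
        by (simp add: \<K>_def sum.inter_restrict)
      also have "\<dots> = (\<Sum>m\<in>card ` \<K>. \<Sum>A | A \<in> \<K> \<and> card A = m. h A)"
        using \<open>finite \<K>\<close> by (intro sum.group[symmetric]) auto
      also have "\<dots> \<le> (\<Sum>m\<in>card ` \<K>. \<Sum>A | A \<subseteq> {1..N m} \<and> card A = m. h A)"
        by (intro sum_mono sum_mono2) (auto simp: h_def \<K>_def \<G>_def intro: finite_subset[of _ "Pow {1..N m}" for m])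
      also have "\<dots> \<le> (\<Sum>m\<in>card ` \<K>. w m)"
        unfolding h_def w_def using assms \<open>p > 0\<close> N \<eta>_def \<open>\<eta> > 0\<close>
        by (intro sum_mono sum_diameter_cylinder_le)
      also have "\<dots> \<le> (\<Sum>m. w m)"
        using \<open>summable w\<close> \<open>finite \<K>\<close> w_nonneg by (intro sum_le_suminf) auto
      finally show "(\<Sum>k<n. diameter (V k) powr t) \<le> (\<Sum>m. w m)" .
    qed simp
    \<comment> \<open>Each \<open>n\<close> with \<open>d\<^sub>n \<le> n\<^sup>p\<close> provides an admitted cylinder around \<open>x\<close>, since \<open>d\<^sub>n\<close> is the
    largest of the first \<open>n\<close> digits; distinct levels give distinct indices.\<close>
    fix x assume x: "x \<in> pierce_div s"
    then have xi: "x \<in> infinite_pierce" using assms by (simp add: pierce_div_eq)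
    note inj = strict_mono_imp_inj_on[OF strict_mono_digit[OF xi]]
    define P where "P = {n. real (digit x n) \<le> real (Suc n) powr p}"
    define K where "K n = set_encode (digit x ` {..<Suc n})" for n
    have card: "card (digit x ` {..<n}) = n" for n
      using inj by (simp add: card_image inj_on_subset)
    have "K n \<in> {k. x \<in> V k}" if "n \<in> P" for n
    proof -
      have "digit x i \<le> N (Suc n)" if "i < Suc n" for i
      proof -
        have "digit x i \<le> digit x n"
          using that strict_mono_digit[OF xi] by (simp add: strict_mono_less_eq)
        also have "digit x n \<le> N (Suc n)"
          using \<open>n \<in> P\<close> by (simp add: P_def N_def le_nat_floor)
        finally show ?thesis .
      qed
      then have "digit x ` {..<Suc n} \<in> \<G>"
        using digit_bounds(1)[OF xi] by (auto simp: \<G>_def card simp del: lessThan_Suc)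
      then show ?thesis
        using xi by (simp add: K_def V_def cylinder_def card del: lessThan_Suc image_insert)
    qed
    moreover have "inj K"
      by (rule injI) (metis K_def card finite_imageI finite_lessThan nat.inject set_encode_eq)
    moreover have "infinite P"
      using frequently_digit_le[OF \<open>0 < s\<close> ps(1) x] by (simp add: P_def frequently_cofinite)
    ultimately show "\<exists>\<^sub>\<infinity>k. x \<in> V k"
      unfolding frequently_cofinite
      by (metis (no_types, lifting) finite_imageD image_subsetI inj_on_subset rev_finite_subset subset_UNIV)
  qed (rule \<open>0 < t\<close>)
qed

section \<open>Points with prescribed digits\<close>

text \<open>
  The alternating series that recovers a number from its Pierce digits, here starting with index \<open>0\<close>.
\<close>

definition pierce_series :: "(nat \<Rightarrow> nat) \<Rightarrow> real" where
  "pierce_series d = (\<Sum>n. (-1) ^ n * (1 / (\<Prod>i\<le>n. real (d i))))"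

text \<open>
  The bounds are those of the alternating series test. The recursion is the inverse of \<open>x \<mapsto> 1 - d\<^sub>1 x\<close>.
\<close>

lemma pierce_series:
  assumes d: "strict_mono d" "d 0 \<ge> 1"
  shows "0 \<le> pierce_series d" "pierce_series d \<le> 1 / real (d 0)"
    and "pierce_series d = (1 - pierce_series (\<lambda>n. d (Suc n))) / real (d 0)"
proof -
  have series: "summable (\<lambda>n. (-1) ^ n * (1 / (\<Prod>i\<le>n. real (e i)))) \<and>
      0 \<le> pierce_series e \<and> pierce_series e \<le> 1 / real (e 0)"
    if e: "strict_mono e" "e 0 \<ge> 1" for e
  proof -
    have e_ge: "real (e n) \<ge> real (Suc n)" for n
    proof (induction n)
      case (Suc n)
      then show ?case using strict_monoD[OF e(1), of n "Suc n"] by simp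
    qed (use e(2) in simp)
    have e_ge_1: "real (e n) \<ge> 1" for n
      using e_ge[of n] by simp
    have prod_ge: "(\<Prod>i\<le>n. real (e i)) \<ge> real (Suc n)" for n
    proof (cases n)
      case (Suc m)
      have "1 * real (Suc n) \<le> (\<Prod>i\<le>m. real (e i)) * real (e n)"
        using e_ge e_ge_1 by (intro mult_mono prod_ge_1 prod_nonneg) simp_all
      then show ?thesis using Suc by simp
    qed (use e(2) in simp)
    define a where "a n = 1 / (\<Prod>i\<le>n. real (e i))" for n
    have a_pos: "a n \<ge> 0" for n by (simp add: a_def prod_nonneg)
    have a_le: "a n \<le> 1 / real (Suc n)" for n
      unfolding a_def using prod_ge by (intro divide_left_mono) (auto intro!: mult_pos_pos less_le_trans[OF _ prod_ge])
    have "a \<longlonglongrightarrow> 0"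
      by (rule tendsto_sandwich[OF _ _ tendsto_const LIMSEQ_Suc[OF lim_1_over_n]])
        (use a_pos a_le in auto)
    moreover have "a (Suc n) \<le> a n" for n
    proof -
      have "a (Suc n) = a n / real (e (Suc n))" by (simp add: a_def)
      also have "\<dots> \<le> a n / 1"
        using a_pos e_ge[of "Suc n"] by (intro divide_left_mono) auto
      finally show ?thesis by simp
    qed
    ultimately have "summable (\<lambda>n. (-1) ^ n * a n) \<and> 0 \<le> (\<Sum>n. (-1) ^ n * a n) \<and> (\<Sum>n. (-1) ^ n * a n) \<le> a 0"
      using summable_Leibniz'(1)[of a] summable_Leibniz'(2)[of a 0] summable_Leibniz'(4)[of a 0] a_pos
      by auto
    then show ?thesis by (simp add: a_def pierce_series_def)
  qed
  from series[OF d] show "0 \<le> pierce_series d" "pierce_series d \<le> 1 / real (d 0)" by auto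
  let ?d' = "\<lambda>n. d (Suc n)"
  let ?a' = "\<lambda>n. 1 / (\<Prod>i\<le>n. real (?d' i))"
  have d': "strict_mono ?d'" "?d' 0 \<ge> 1"
    using d(1) strict_monoD[OF d(1) zero_less_one] d(2) by (simp add: strict_mono_Suc_iff, simp)
  have "(\<lambda>n. (-1) ^ n * ?a' n) sums pierce_series ?d'"
    using series[OF d'] by (auto simp: pierce_series_def intro: summable_sums)
  then have "(\<lambda>n. - (1 / real (d 0)) * ((-1) ^ n * ?a' n)) sums (- (1 / real (d 0)) * pierce_series ?d')"
    by (rule sums_mult)
  moreover have "- (1 / real (d 0)) * ((-1) ^ n * ?a' n) = (-1) ^ Suc n * (1 / (\<Prod>i\<le>Suc n. real (d i)))" for n
    by (subst prod.atMost_Suc_shift) simp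
  ultimately have "(\<lambda>n. (-1) ^ Suc n * (1 / (\<Prod>i\<le>Suc n. real (d i)))) sums (- (1 / real (d 0)) * pierce_series ?d')"
    by simp
  then have "(\<lambda>n. (-1) ^ n * (1 / (\<Prod>i\<le>n. real (d i)))) sums (- (1 / real (d 0)) * pierce_series ?d' + 1 / real (d 0))"
    by (subst (asm) sums_Suc_iff) simp
  then have "pierce_series d = - (1 / real (d 0)) * pierce_series ?d' + 1 / real (d 0)"
    unfolding pierce_series_def by (rule sums_unique[symmetric])
  then show "pierce_series d = (1 - pierce_series ?d') / real (d 0)"
    by (simp add: diff_divide_distrib)
qed

text \<open>
  The recursion \<open>x = (1 - y) / d\<close> identifies \<open>d\<close> as \<open>\<lfloor>1 / x\<rfloor>\<close> provided that \<open>y > 0\<close> and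
  \<open>y < 1 / (d + 1)\<close>. The second, strict inequality needs one more step of the recursion: \<open>y\<close> is
  strictly less than the reciprocal of the next digit, which is at least \<open>d + 1\<close>.
\<close>

lemma pierce_series_step:
  assumes d: "strict_mono d" "d 0 \<ge> 1"
  shows "pierce_series d > 0" "pierce_d1 (pierce_series d) = enat (d 0)"
    and "pierce_T (pierce_series d) = pierce_series (\<lambda>n. d (Suc n))"
proof -
  have pos: "pierce_series e > 0" if e: "strict_mono e" "e 0 \<ge> 1" for e
  proof -
    have e': "strict_mono (\<lambda>n. e (Suc n))" "e (Suc 0) \<ge> 2"
      using e(1) strict_monoD[OF e(1) zero_less_one] e(2) by (simp add: strict_mono_Suc_iff, simp)
    have "pierce_series (\<lambda>n. e (Suc n)) \<le> 1 / real (e (Suc 0))"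
      using e' by (intro pierce_series) auto
    also have "\<dots> < 1" using e'(2) by simp
    finally show ?thesis
      using pierce_series(3)[OF e] e(2) by simp
  qed
  let ?x = "pierce_series d" and ?y = "pierce_series (\<lambda>n. d (Suc n))"
  have d': "strict_mono (\<lambda>n. d (Suc n))" "d 0 < d (Suc 0)"
    using d by (auto simp: strict_mono_Suc_iff)
  have d'': "strict_mono (\<lambda>n. d (Suc (Suc n)))" "d (Suc 0) < d (Suc (Suc 0))"
    using d by (auto simp: strict_mono_Suc_iff)
  have "?x > 0" using d by (rule pos)
  have "?y > 0" using d' by (intro pos) auto
  have x: "real (d 0) * ?x = 1 - ?y" using pierce_series(3)[OF d] d(2) by simp
  have "real (d (Suc 0)) * ?y < 1"
    using pierce_series(3)[OF d'(1)] d'(2) pos[OF d''(1)] d''(2) by simp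
  moreover have "(real (d 0) + 1) * ?y \<le> real (d (Suc 0)) * ?y"
    using d'(2) \<open>?y > 0\<close> by (intro mult_right_mono) auto
  ultimately have "(real (d 0) + 1) * ?y < 1" by simp
  then have "real (d 0) < (real (d 0) + 1) * (1 - ?y)"
    by (simp add: algebra_simps)
  then have "real (d 0) * 1 < real (d 0) * ((real (d 0) + 1) * ?x)"
    unfolding x[symmetric] by (simp add: mult_ac)
  then have "1 < (real (d 0) + 1) * ?x" using d(2) by (simp only: mult_less_cancel_left)
  then have "\<lfloor>1 / ?x\<rfloor> = int (d 0)"
    using x \<open>?y > 0\<close> \<open>?x > 0\<close> by (intro floor_unique) (simp_all add: field_simps)
  then show d1: "pierce_d1 ?x = enat (d 0)"
    using \<open>?x > 0\<close> by (simp add: pierce_d1_def)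
  show "?x > 0" by fact
  show "pierce_T ?x = ?y"
    using \<open>?x > 0\<close> x by (simp add: pierce_T_def d1)
qed

lemma ex_digit_eq:
  assumes d: "strict_mono d" "d 0 \<ge> 1"
  shows "\<exists>x\<in>infinite_pierce. digit x = d"
proof (rule bexI)
  let ?x = "pierce_series d"
  have shift: "strict_mono (\<lambda>i. d (i + n))" "d (0 + n) \<ge> 1" for n
    using d strict_mono_less_eq[OF d(1), of 0 n] by (auto simp: strict_mono_Suc_iff)
  have iter: "(pierce_T ^^ n) ?x = pierce_series (\<lambda>i. d (i + n))" for n
  proof (induction n)
    case (Suc n)
    then show ?case using pierce_series_step(3)[OF shift[of n]] by simp
  qed simp
  show "digit ?x = d"
  proof
    fix n
    show "digit ?x n = d n"
      using pierce_series_step(2)[OF shift[of n]] by (simp add: digit_def pierce_digit_def iter)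
  qed
  have "1 / real (d 0) \<le> 1" using d(2) by simp
  then show "?x \<in> infinite_pierce"
    using pierce_series_step(1)[OF shift, THEN less_imp_neq] pierce_series(1,2)[OF d]
    by (simp add: infinite_pierce_def iter)
qed

text \<open>
  Let \<open>u\<close> and \<open>v\<close> be the \<open>n\<close>-th iterates, with first digits \<open>d\<close> and at least \<open>d + 1\<close>. Then
  \<open>v \<le> 1 / (d + 1)\<close>. In general \<open>u\<close> may be arbitrarily close to \<open>1 / (d + 1)\<close>, but the gap of \<open>2\<close> before the
  next digit gives \<open>T u \<le> 1 / (d + 2)\<close>, so \<open>u \<ge> (1 - 1 / (d + 2)) / d\<close>. The difference of the two
  bounds is exactly \<open>1 / (d (d + 1) (d + 2))\<close>.
\<close>

lemma dist_ge_if_digits_differ: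
  assumes x: "x \<in> infinite_pierce" and y: "y \<in> infinite_pierce"
    and eq: "\<And>i. i < n \<Longrightarrow> digit x i = digit y i" and less: "digit x n < digit y n"
    and gap: "digit x (Suc n) \<ge> digit x n + 2" and d: "d = real (digit x n)"
  shows "\<bar>x - y\<bar> * ((\<Prod>i<n. real (digit x i)) * (d * (d + 1) * (d + 2))) \<ge> 1"
proof -
  define u v where "u = (pierce_T ^^ n) x" and "v = (pierce_T ^^ n) y"
  have "d > 0" using digit_bounds(1)[OF x, of n] d by simp
  have "(d + 2) * (1 - d * u) \<le> real (digit x (Suc n)) * (1 - d * u)"
    using iterate_pos[OF x, of "Suc n"] gap unfolding digit_bounds(4)[OF x]
    by (intro mult_right_mono) (auto simp: d u_def)
  also have "\<dots> \<le> 1"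
    using digit_bounds(2)[OF x, of "Suc n"] unfolding digit_bounds(4)[OF x] by (simp only: d u_def)
  finally have u: "d + 1 \<le> (d * (d + 2)) * u" by (simp add: algebra_simps)
  have "(d + 1) * v \<le> real (digit y n) * v"
    using iterate_pos[OF y, of n] less by (intro mult_right_mono) (auto simp: d v_def)
  also have "\<dots> \<le> 1" using digit_bounds(2)[OF y, of n] by (simp add: v_def)
  finally have v: "(d + 1) * v \<le> 1" .
  have "(d + 1) * (d + 1) \<le> (d + 1) * ((d * (d + 2)) * u)"
    using u \<open>d > 0\<close> by (intro mult_left_mono) auto
  moreover have "(d * (d + 2)) * ((d + 1) * v) \<le> (d * (d + 2)) * 1"
    using v \<open>d > 0\<close> by (intro mult_left_mono) auto
  ultimately have "1 \<le> (u - v) * (d * (d + 1) * (d + 2))" by (simp add: algebra_simps)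
  also have "\<dots> \<le> \<bar>u - v\<bar> * (d * (d + 1) * (d + 2))"
    using \<open>d > 0\<close> by (intro mult_right_mono) auto
  also have "\<bar>u - v\<bar> = (\<Prod>i<n. real (digit x i)) * \<bar>x - y\<bar>"
    unfolding u_def v_def using x y eq by (rule iterate_dist)
  finally show ?thesis by (simp add: mult_ac)
qed

section \<open>The lower bound for the dimension\<close>

text \<open>
  In the mixed radix system with radices \<open>radix q n\<close>, the place with index \<open>n\<close> of \<open>y \<in> [0,1)\<close> is
  \<open>\<lfloor>m M y\<rfloor> - m \<lfloor>M y\<rfloor>\<close>, where \<open>m\<close> is the radix at \<open>n\<close> and \<open>M\<close> the product of the previous ones. The
  Pierce digit \<open>cantor_digit q y n\<close> is the element with this number of a block of \<open>m\<close> integers. One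
  integer is left out between successive blocks, so that successive digits differ by at least \<open>2\<close>,
  as \<open>dist_ge_if_digits_differ\<close> requires.
\<close>

definition radix :: "real \<Rightarrow> nat \<Rightarrow> nat" where
  "radix q n = nat \<lceil>real (Suc n) powr q\<rceil>"

definition radix_prod :: "real \<Rightarrow> nat \<Rightarrow> nat" where
  "radix_prod q n = (\<Prod>i<n. radix q i)"

definition block_start :: "real \<Rightarrow> nat \<Rightarrow> nat" where
  "block_start q n = 1 + (\<Sum>i<n. radix q i + 1)"

definition cantor_digit :: "real \<Rightarrow> real \<Rightarrow> nat \<Rightarrow> nat" where
  "cantor_digit q y n = block_start q n
     + nat (\<lfloor>real (radix_prod q (Suc n)) * y\<rfloor> - int (radix q n) * \<lfloor>real (radix_prod q n) * y\<rfloor>)"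

definition cantor_point :: "real \<Rightarrow> real \<Rightarrow> real" where
  "cantor_point q y = (SOME x. x \<in> infinite_pierce \<and> digit x = cantor_digit q y)"

lemma floor_mult_diff_bounds:
  fixes x :: real and m :: nat
  assumes "m > 0"
  shows "\<lfloor>real m * x\<rfloor> - int m * \<lfloor>x\<rfloor> \<in> {0..<int m}"
proof -
  have "real m * of_int \<lfloor>x\<rfloor> \<le> real m * x" by (intro mult_left_mono) auto
  then have "int m * \<lfloor>x\<rfloor> \<le> \<lfloor>real m * x\<rfloor>" by (simp add: le_floor_iff)
  moreover have "real m * x < real m * (of_int \<lfloor>x\<rfloor> + 1)"
    using assms by (intro mult_strict_left_mono) linarith+
  then have "\<lfloor>real m * x\<rfloor> < int m * (\<lfloor>x\<rfloor> + 1)" by (simp add: floor_less_iff)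
  ultimately show ?thesis by (simp add: algebra_simps)
qed

text \<open>
  The right-hand side contains the left-hand side as a term of the exponential series. This is how
  exponential factors are absorbed into a power of the factorial.
\<close>

lemma power_le_exp_fact: "0 \<le> c \<Longrightarrow> c ^ n \<le> exp c * fact n" for c :: real
proof -
  assume "0 \<le> c"
  have sums: "(\<lambda>n. c ^ n / fact n) sums exp c"
    using exp_converges[of c] by (simp add: divide_inverse mult.commute)
  have "c ^ n / fact n = (\<Sum>k\<in>{n}. c ^ k / fact k)" by simp
  also have "\<dots> \<le> (\<Sum>k. c ^ k / fact k)"
    using \<open>0 \<le> c\<close> sums by (intro sum_le_suminf) (auto simp: sums_iff)
  also have "\<dots> = exp c" using sums by (simp add: sums_iff)
  finally show ?thesis by (simp add: pos_divide_le_eq)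
qed

lemma power_powr: "b > 0 \<Longrightarrow> (b ^ n) powr a = (b powr a) ^ n" for a b :: real
  by (induction n) (simp_all add: powr_mult)

lemma prod_Suc_powr: "(\<Prod>i<n. real (Suc i) powr q) = fact n powr q"
proof -
  have "fact n = (\<Prod>i<n. real (Suc i))"
    by (induction n) (simp_all add: algebra_simps)
  then show ?thesis by (simp add: prod_powr_distrib)
qed

context
  fixes q :: real assumes q: "q \<ge> 0"
begin

lemma radix_bounds:
  "real (Suc n) powr q \<le> real (radix q n)" "real (radix q n) \<le> 2 * real (Suc n) powr q"
  "radix q n \<ge> 1"
proof -
  have 1: "1 \<le> real (Suc n) powr q" using q by (simp add: ge_one_powr_ge_zero)
  then have "real (radix q n) = of_int \<lceil>real (Suc n) powr q\<rceil>"
    unfolding radix_def by (intro of_nat_nat) linarith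
  with 1 show "real (Suc n) powr q \<le> real (radix q n)" "real (radix q n) \<le> 2 * real (Suc n) powr q"
    "radix q n \<ge> 1"
    by linarith+
qed

lemma radix_prod_ge: "fact n powr q \<le> real (radix_prod q n)"
  unfolding radix_prod_def of_nat_prod prod_Suc_powr[symmetric]
  using radix_bounds(1) by (intro prod_mono) auto

lemma radix_prod_pos: "radix_prod q n > 0"
  unfolding radix_prod_def using radix_bounds(3) by (intro prod_pos) (auto intro: less_le_trans)

lemma cantor_digit_bounds:
  "block_start q n \<le> cantor_digit q y n" "cantor_digit q y n < block_start q n + radix q n"
proof -
  have "\<lfloor>real (radix q n) * (real (radix_prod q n) * y)\<rfloor> - int (radix q n) * \<lfloor>real (radix_prod q n) * y\<rfloor>
      \<in> {0..<int (radix q n)}"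
    using radix_bounds(3)[of n] by (intro floor_mult_diff_bounds) simp
  then show "cantor_digit q y n < block_start q n + radix q n"
    by (simp add: cantor_digit_def radix_prod_def mult_ac nat_less_iff)
qed (simp add: cantor_digit_def)

lemma cantor_digit_gap: "cantor_digit q y n + 2 \<le> cantor_digit q z (Suc n)"
  using cantor_digit_bounds(2)[of y n] cantor_digit_bounds(1)[of "Suc n" z] by (simp add: block_start_def)

lemma cantor_digit_0_ge: "cantor_digit q y 0 \<ge> 1"
  using cantor_digit_bounds(1)[of 0 y] by (simp add: block_start_def)

lemma cantor_point: "cantor_point q y \<in> infinite_pierce" "digit (cantor_point q y) = cantor_digit q y"
proof -
  have "strict_mono (cantor_digit q y)"
  proof (rule strict_monoI_Suc)
    show "cantor_digit q y n < cantor_digit q y (Suc n)" for n using cantor_digit_gap[of y n y] by simp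
  qed
  then have "\<exists>x. x \<in> infinite_pierce \<and> digit x = cantor_digit q y"
    using ex_digit_eq cantor_digit_0_ge by blast
  then have "cantor_point q y \<in> infinite_pierce \<and> digit (cantor_point q y) = cantor_digit q y"
    unfolding cantor_point_def by (rule someI_ex)
  then show "cantor_point q y \<in> infinite_pierce" "digit (cantor_point q y) = cantor_digit q y" by auto
qed

text \<open>
  A digit lies below the start of the next block, which is \<open>1\<close> plus the total length of the first
  \<open>n + 1\<close> blocks with their separators, each of length at most \<open>3 (n + 1)\<^sup>q\<close>.
\<close>

lemma cantor_digit_le: "real (cantor_digit q y n) \<le> 3 * real (Suc n) powr (q + 1)"
proof -
  have "real (radix q i + 1) \<le> 3 * real (Suc n) powr q" if "i \<le> n" for i
  proof -
    have "real (Suc i) powr q \<le> real (Suc n) powr q" using that q by (intro powr_mono2) auto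
    moreover have "1 \<le> real (Suc n) powr q" using q by (simp add: ge_one_powr_ge_zero)
    ultimately show ?thesis using radix_bounds(2)[of i] by simp
  qed
  then have "(\<Sum>i<Suc n. real (radix q i + 1)) \<le> (\<Sum>i<Suc n. 3 * real (Suc n) powr q)"
    by (intro sum_mono) simp
  also have "\<dots> = 3 * real (Suc n) powr (q + 1)"
    by (simp add: powr_add)
  finally have "real (block_start q (Suc n)) \<le> 1 + 3 * real (Suc n) powr (q + 1)"
    by (simp add: block_start_def del: sum.lessThan_Suc)
  moreover have "cantor_digit q y n + 2 \<le> block_start q (Suc n)"
    using cantor_digit_bounds(2)[of y n] by (simp add: block_start_def)
  ultimately show ?thesis by linarith
qed

text \<open>
  Since \<open>(q + 1) s = 1\<close>, the bound \<open>cantor_digit_le\<close> makes the terms at least \<open>3\<^bsup>- s\<^esup> / (n + 1)\<close>.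
\<close>

lemma cantor_point_in_pierce_div:
  assumes "s > 0" "(q + 1) * s = 1"
  shows "cantor_point q y \<in> pierce_div s"
proof -
  have "\<not> summable (\<lambda>n. 3 powr - s * real (Suc n) powr - 1)"
    by (subst summable_cmult_iff, subst summable_Suc_iff, subst summable_real_powr_iff) simp_all
  moreover have "norm (3 powr - s * real (Suc n) powr - 1) \<le> real (cantor_digit q y n) powr - s" for n
  proof -
    have "(q + 1) * - s = - 1" using assms by simp
    then have "3 powr - s * real (Suc n) powr - 1 = (3 * real (Suc n) powr (q + 1)) powr - s"
      by (simp only: powr_mult powr_powr)
    also have "\<dots> \<le> real (cantor_digit q y n) powr - s"
      using cantor_digit_le[of y n] cantor_digit_bounds(1)[of n y] \<open>s > 0\<close>
      by (intro powr_mono2') (auto simp: block_start_def)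
    finally show ?thesis by simp
  qed
  ultimately have "\<not> summable (\<lambda>n. real (cantor_digit q y n) powr - s)"
    using summable_comparison_test'[of _ 0 "\<lambda>n. 3 powr - s * real (Suc n) powr - 1"] by blast
  then show ?thesis
    using cantor_point[of y] \<open>s > 0\<close> by (simp add: pierce_div_eq)
qed

lemma cantor_digit_eq_iff_floor_eq:
  assumes "\<lfloor>real (radix_prod q n) * y\<rfloor> = \<lfloor>real (radix_prod q n) * z\<rfloor>"
  shows "cantor_digit q y n = cantor_digit q z n \<longleftrightarrow> \<lfloor>real (radix_prod q (Suc n)) * y\<rfloor> = \<lfloor>real (radix_prod q (Suc n)) * z\<rfloor>"
proof -
  have "int (cantor_digit q v n) = int (block_start q n)
      + (\<lfloor>real (radix_prod q (Suc n)) * v\<rfloor> - int (radix q n) * \<lfloor>real (radix_prod q n) * v\<rfloor>)" for v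
    using cantor_digit_bounds(1)[of n v] floor_mult_diff_bounds[of "radix q n" "real (radix_prod q n) * v"] radix_bounds(3)[of n]
    by (simp add: cantor_digit_def radix_prod_def mult_ac)
  then show ?thesis
    unfolding of_nat_eq_iff[where 'a = int, symmetric] using assms by simp
qed

text \<open>
  Agreement of the first \<open>n\<close> places means that \<open>y\<close> and \<open>z\<close> have the same integer part after
  multiplication by the product of the first \<open>n\<close> radices. This product tends to infinity because
  \<open>q > 0\<close>, so distinct numbers are told apart at some place.
\<close>

lemma first_different_digit:
  assumes "q > 0" and yz: "y \<in> {0..<1}" "z \<in> {0..<1}" "y \<noteq> z"
  obtains n where "\<And>i. i < n \<Longrightarrow> cantor_digit q y i = cantor_digit q z i" "cantor_digit q y n \<noteq> cantor_digit q z n"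
    "\<bar>y - z\<bar> * real (radix_prod q n) \<le> 1"
proof -
  define eq where "eq n \<longleftrightarrow> \<lfloor>real (radix_prod q n) * y\<rfloor> = \<lfloor>real (radix_prod q n) * z\<rfloor>" for n
  have close: "\<bar>y - z\<bar> * real (radix_prod q n) \<le> 1" if "eq n" for n
  proof -
    have "\<bar>real (radix_prod q n) * y - real (radix_prod q n) * z\<bar> \<le> 1"
      using that unfolding eq_def by linarith
    also have "real (radix_prod q n) * y - real (radix_prod q n) * z = (y - z) * real (radix_prod q n)"
      by (simp add: algebra_simps)
    finally show ?thesis by (simp add: abs_mult)
  qed
  obtain n :: nat where n: "(1 / \<bar>y - z\<bar>) powr (1 / q) < real n"
    using reals_Archimedean2 by blast
  have "1 / \<bar>y - z\<bar> = ((1 / \<bar>y - z\<bar>) powr (1 / q)) powr q"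
    using \<open>q > 0\<close> yz by (simp add: powr_powr)
  also have "\<dots> < real n powr q"
    using n \<open>q > 0\<close> by (intro powr_less_mono2) auto
  also have "\<dots> \<le> fact n powr q"
    using q of_nat_mono[OF fact_ge_self[of n], where 'a = real] by (intro powr_mono2) simp_all
  also have "\<dots> \<le> real (radix_prod q n)" by (rule radix_prod_ge)
  finally have "1 < \<bar>y - z\<bar> * real (radix_prod q n)" using yz by (simp add: field_simps)
  then have "\<not> eq n" using close by force
  define m where "m = (LEAST m. \<not> eq m)"
  have "\<not> eq m" unfolding m_def using \<open>\<not> eq n\<close> by (rule LeastI)
  have lt: "eq i" if "i < m" for i using that not_less_Least unfolding m_def by blast
  have "\<lfloor>y\<rfloor> = 0" "\<lfloor>z\<rfloor> = 0" using yz by (simp_all add: floor_eq_iff)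
  then have "eq 0" by (simp add: eq_def radix_prod_def)
  with \<open>\<not> eq m\<close> obtain j where j: "m = Suc j" by (metis not0_implies_Suc)
  show ?thesis
  proof
    show "cantor_digit q y i = cantor_digit q z i" if "i < j" for i
      using cantor_digit_eq_iff_floor_eq[of i y z] lt[of i] lt[of "Suc i"] that j by (simp add: eq_def)
    show "cantor_digit q y j \<noteq> cantor_digit q z j"
      using cantor_digit_eq_iff_floor_eq[of j y z] lt[of j] \<open>\<not> eq m\<close> j by (simp add: eq_def)
    show "\<bar>y - z\<bar> * real (radix_prod q j) \<le> 1" using close lt j by simp
  qed
qed

text \<open>
  With \<open>d \<le> 3 (n + 1)\<^bsup>q + 1\<^esup>\<close>, the factor \<open>d (d + 1) (d + 2)\<close> is at most
  \<open>6 d\<^sup>3 \<le> 162 (n + 1)\<^bsup>3 (q + 1)\<^esup>\<close>. This polynomial contribution is estimated crudely by the exponential one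
  \<open>162 (8\<^bsup>q + 1\<^esup>)\<^sup>n\<close>, using \<open>n + 1 \<le> 2\<^sup>n\<close>.
\<close>

lemma dist_cantor_point_ge:
  assumes eq: "\<And>i. i < n \<Longrightarrow> cantor_digit q y i = cantor_digit q z i" and less: "cantor_digit q y n < cantor_digit q z n"
  shows "1 \<le> \<bar>cantor_point q y - cantor_point q z\<bar> * (162 * (3 * 8 powr (q + 1)) ^ n * fact n powr (q + 1))"
proof -
  define d where "d = real (cantor_digit q y n)"
  have d: "0 \<le> d" "1 \<le> d" "d \<le> 3 * real (Suc n) powr (q + 1)"
    using cantor_digit_le[of y n] cantor_digit_bounds(1)[of n y] by (auto simp: d_def block_start_def)
  have "d * (d + 1) * (d + 2) \<le> d * (2 * d) * (3 * d)"
    using d by (intro mult_mono) auto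
  also have "\<dots> = 6 * d ^ 3" by (simp add: power3_eq_cube)
  also have "\<dots> \<le> 6 * (3 * real (Suc n) powr (q + 1)) ^ 3"
    using d by (intro mult_left_mono power_mono) auto
  also have "\<dots> \<le> 6 * (3 * ((2 ^ n) powr (q + 1))) ^ 3"
  proof -
    have "real (Suc n) \<le> real (2 ^ n)"
      using less_exp[of n] by (subst of_nat_le_iff) (rule Suc_leI)
    then show ?thesis using q by (intro mult_left_mono power_mono powr_mono2) auto
  qed
  also have "\<dots> = 162 * ((2 ^ n) powr (q + 1)) ^ 3" by (simp add: power_mult_distrib)
  also have "((2 ^ n) powr (q + 1)) ^ 3 = ((8::real) powr (q + 1)) ^ n"
  proof -
    have "((2 ^ n) powr (q + 1)) ^ 3 = (((2::real) powr (q + 1)) ^ 3) ^ n"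
      by (simp add: power_powr flip: power_mult) (simp add: mult.commute)
    also have "((2::real) powr (q + 1)) ^ 3 = (2 ^ 3) powr (q + 1)"
      by (simp only: power_powr zero_less_numeral)
    finally show ?thesis by simp
  qed
  finally have cube: "d * (d + 1) * (d + 2) \<le> 162 * (8 powr (q + 1)) ^ n" .
  have "(\<Prod>i<n. real (cantor_digit q y i)) \<le> (\<Prod>i<n. 3 * real (Suc i) powr (q + 1))"
    using cantor_digit_le by (intro prod_mono) auto
  also have "\<dots> = 3 ^ n * fact n powr (q + 1)"
    by (simp only: prod.distrib prod_Suc_powr) simp
  finally have prod: "(\<Prod>i<n. real (cantor_digit q y i)) \<le> 3 ^ n * fact n powr (q + 1)" .
  have "1 \<le> \<bar>cantor_point q y - cantor_point q z\<bar> * ((\<Prod>i<n. real (digit (cantor_point q y) i)) * (d * (d + 1) * (d + 2)))"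
    using eq less cantor_digit_gap[of y n y] by (intro dist_ge_if_digits_differ cantor_point) (auto simp: cantor_point d_def)
  also have "\<dots> = \<bar>cantor_point q y - cantor_point q z\<bar> * ((\<Prod>i<n. real (cantor_digit q y i)) * (d * (d + 1) * (d + 2)))"
    by (simp add: cantor_point)
  also have "\<dots> \<le> \<bar>cantor_point q y - cantor_point q z\<bar> * ((3 ^ n * fact n powr (q + 1)) * (162 * (8 powr (q + 1)) ^ n))"
    using d by (intro mult_left_mono mult_mono[OF prod cube]) simp_all
  finally show ?thesis by (simp add: power_mult_distrib mult_ac)
qed

end

text \<open>
  The distance of \<open>y\<close> and \<open>z\<close> is at most \<open>(n!)\<^bsup>- q\<^esup>\<close>, where \<open>n\<close> is the first place where they differ, and
  the \<open>t\<close>-th power of the distance of their images is at least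
  \<open>162\<^bsup>- t\<^esup> L\<^bsup>- t n\<^esup> (n!)\<^bsup>- (q + 1) t\<^esup>\<close>. As \<open>t < 1 - s = q / (q + 1)\<close>, the exponent
  \<open>\<epsilon> = q - (q + 1) t\<close> is positive, and \<open>(n!)\<^bsup>\<epsilon>\<^esup>\<close> outgrows \<open>L\<^bsup>t n\<^esup>\<close>.
\<close>

lemma hausdorff_measure_pierce_div_neq_0:
  assumes "0 < s" "0 \<le> t" "t < 1 - s"
  shows "hausdorff_measure t (pierce_div s) \<noteq> 0"
proof -
  define q where "q = 1 / s - 1"
  define \<epsilon> where "\<epsilon> = q - (q + 1) * t"
  have "q > 0" using assms by (simp add: q_def)
  have qs: "(q + 1) * s = 1" using assms by (simp add: q_def)
  have "\<epsilon> = (1 - s - t) / s" using assms by (simp add: \<epsilon>_def q_def field_simps)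
  then have "\<epsilon> > 0" using assms by simp
  define L where "L = 3 * 8 powr (q + 1)"
  have "L > 0" by (simp add: L_def)
  \<comment> \<open>With this \<open>c\<close>, the exponential factor \<open>L\<^bsup>t n\<^esup>\<close> equals \<open>(c\<^sup>n)\<^bsup>\<epsilon>\<^esup>\<close> and is bounded by a constant times \<open>(n!)\<^bsup>\<epsilon>\<^esup>\<close>.\<close>
  define c where "c = L powr (t / \<epsilon>)"
  define C where "C = 162 powr t * exp c powr \<epsilon>"
  have main: "\<bar>y - z\<bar> \<le> C * dist (cantor_point q y) (cantor_point q z) powr t"
    if yz: "y \<in> {0..<1}" "z \<in> {0..<1}" "y \<noteq> z" for y z
  proof -
    obtain n where n: "\<And>i. i < n \<Longrightarrow> cantor_digit q y i = cantor_digit q z i" "cantor_digit q y n \<noteq> cantor_digit q z n"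
        "\<bar>y - z\<bar> * real (radix_prod q n) \<le> 1"
      using first_different_digit[of q y z] \<open>q > 0\<close> yz by auto
    define r where "r = dist (cantor_point q y) (cantor_point q z)"
    consider "cantor_digit q y n < cantor_digit q z n" | "cantor_digit q z n < cantor_digit q y n" using n(2) by linarith
    then have "1 \<le> r * (162 * L ^ n * fact n powr (q + 1))"
    proof cases
      case 1
      then show ?thesis
        using dist_cantor_point_ge[of q n y z] n(1) \<open>q > 0\<close> unfolding r_def L_def dist_real_def by simp
    next
      case 2
      then show ?thesis
        using dist_cantor_point_ge[of q n z y] n(1) \<open>q > 0\<close>
        unfolding r_def L_def dist_real_def abs_minus_commute[of "cantor_point q y"] by simp
    qed
    then have "1 powr t \<le> (r * (162 * L ^ n * fact n powr (q + 1))) powr t"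
      using \<open>0 \<le> t\<close> by (intro powr_mono2) auto
    also have "\<dots> = r powr t * (162 powr t * (L ^ n) powr t * fact n powr ((q + 1) * t))"
      using \<open>L > 0\<close> by (simp add: powr_mult powr_powr r_def)
    also have "(L ^ n) powr t = (c ^ n) powr \<epsilon>"
      using \<open>L > 0\<close> \<open>\<epsilon> > 0\<close> by (simp add: c_def power_powr powr_powr)
    also have "r powr t * (162 powr t * (c ^ n) powr \<epsilon> * fact n powr ((q + 1) * t))
        \<le> r powr t * (162 powr t * (exp c * fact n) powr \<epsilon> * fact n powr ((q + 1) * t))"
      using \<open>\<epsilon> > 0\<close> power_le_exp_fact[of c n]
      by (intro mult_left_mono mult_right_mono powr_mono2) (auto simp: c_def)
    also have "\<dots> = C * r powr t * fact n powr (\<epsilon> + (q + 1) * t)"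
      by (simp add: powr_mult powr_add C_def mult_ac)
    also have "\<epsilon> + (q + 1) * t = q" by (simp add: \<epsilon>_def)
    also have "C * r powr t * fact n powr q \<le> C * r powr t * real (radix_prod q n)"
      using radix_prod_ge[of q n] \<open>q > 0\<close> by (intro mult_left_mono) (auto simp: C_def)
    finally have "1 \<le> C * r powr t * real (radix_prod q n)" by simp
    with n(3) have "\<bar>y - z\<bar> * real (radix_prod q n) \<le> C * r powr t * real (radix_prod q n)" by simp
    then show ?thesis
      using radix_prod_pos[of q n] \<open>q > 0\<close> unfolding r_def by (simp add: mult_le_cancel_right)
  qed
  show ?thesis
  proof (rule hausdorff_measure_neq_0_if_inverse_Hoelder[where g = "cantor_point q" and C = C])
    show "cantor_point q ` {0..<1} \<subseteq> pierce_div s"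
      using cantor_point_in_pierce_div[OF _ assms(1) qs] \<open>q > 0\<close> by auto
    show "C > 0" by (simp add: C_def)
  qed (use main \<open>0 \<le> t\<close> in simp_all)
qed

section \<open>The dimension of the divergence set\<close>

theorem theorem1p12:
  fixes s :: real
  assumes "0 < s" and "s \<le> 1"
  shows "hausdorff_dim (pierce_div s) = ereal (1 - s)"
proof -
  have "cantor_point (1 / s - 1) 0 \<in> pierce_div s"
    using assms by (intro cantor_point_in_pierce_div) (auto simp: field_simps)
  then have dim: "hausdorff_dim (pierce_div s) =
      (INF t \<in> {t. 0 \<le> t \<and> hausdorff_measure t (pierce_div s) = 0}. ereal t)"
    by (auto simp: hausdorff_dim_def)
  show ?thesis
  proof (rule antisym)
    show "ereal (1 - s) \<le> hausdorff_dim (pierce_div s)"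
      unfolding dim using hausdorff_measure_pierce_div_neq_0[of s] assms
      by (intro INF_greatest) (auto simp: not_le[symmetric])
    show "hausdorff_dim (pierce_div s) \<le> ereal (1 - s)"
    proof (rule ereal_le_epsilon2)
      fix e :: real assume "e > 0"
      \<comment> \<open>The minimum with \<open>s / 2\<close> ensures that \<open>t < 1\<close>.\<close>
      define t where "t = 1 - s + min e (s / 2)"
      have t: "1 - s < t" "0 < t" "t < 1" "t \<le> 1 - s + e"
        using assms \<open>e > 0\<close> by (auto simp: t_def min_def)
      then have "hausdorff_dim (pierce_div s) \<le> ereal t"
        unfolding dim using hausdorff_measure_pierce_div_eq_0[of s t] assms
        by (intro INF_lower) auto
      also have "\<dots> \<le> ereal (1 - s) + ereal e" using t by simp
      finally show "hausdorff_dim (pierce_div s) \<le> ereal (1 - s) + ereal e" .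
    qed
  qed
qed

end
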